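(* Let $(X,d)$ be a metric space, let $f:X\to X$ be a self-mapping, let $u_0\in X$ and $\rho\ge 0$, and let $\theta_\rho:\mathbb{R}\to\mathbb{R}$ be defined by $\theta_\rho(x)=\rho$ if $x=\rho$ and $\theta_\rho(x)=x+\rho$ if $x\ne\rho$. Suppose that (1) there is some $L\in(-\infty,0]$ such that $2d(u,u_0)-d(fu,u_0)\le \theta_\rho(d(u,u_0))+L\,d(u,fu)$ for each $u\in X$; (2) $d(fu,u_0)\le\rho$ for each $u\in C_{u_0,\rho}$; (3) $d(fu,fv)\ge 2\rho$ for each $u,v\in C_{u_0,\rho}$ with $u\ne v$; (4) $d(fu,fv)<\rho+d(v,fu)$ for each $u,v\in C_{u_0,\rho}$ with $u\neq v$. Then $f$ fixes the circle $C_{u_0,\rho}$.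
   Context: For a metric space $(X,d)$, $u_0\in X$ and a radius $\rho$, the circle is $C_{u_0,\rho}=\{u\in X: d(u,u_0)=\rho\}$. A self-mapping $f:X\to X$ fixes the circle $C_{u_0,\rho}$ (equivalently, $C_{u_0,\rho}$ is a fixed circle of $f$) if $fu=u$ for all $u\in C_{u_0,\rho}$. Here $fu$ denotes $f(u)$. *)

theory Defs
  imports "HOL-Analysis.Analysis"
begin

definition fixes_circle :: "('a::metric_space \<Rightarrow> 'a) \<Rightarrow> 'a \<Rightarrow> real \<Rightarrow> bool"
  where "fixes_circle f u0 \<rho> \<longleftrightarrow> (\<forall>u \<in> sphere u0 \<rho>. f u = u)"

definition theta :: "real \<Rightarrow> real \<Rightarrow> real"
  where "theta \<rho> x = (if x = \<rho> then \<rho> else x + \<rho>)"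

end

(* Condition (1) with L <= 0 and condition (2) show that f maps the circle into itself.
   If f u differed from u, then v = f u would be an admissible second point in (3) and (4),
   giving 2 * rho <= d(f u, f v) < rho + d(v, f u) = rho, which is impossible. *)
theory Submission
  imports Defs
begin

theorem theorem2p6:
  fixes f :: "'a::metric_space \<Rightarrow> 'a" and u0 :: 'a and \<rho> :: real
  assumes "\<rho> \<ge> 0"
    and "\<exists>L\<le>0::real. \<forall>u. 2 * dist u u0 - dist (f u) u0 \<le> theta \<rho> (dist u u0) + L * dist u (f u)"
    and "\<forall>u \<in> sphere u0 \<rho>. dist (f u) u0 \<le> \<rho>"
    and "\<forall>u \<in> sphere u0 \<rho>. \<forall>v \<in> sphere u0 \<rho>. u \<noteq> v \<longrightarrow> dist (f u) (f v) \<ge> 2 * \<rho>"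
    and "\<forall>u \<in> sphere u0 \<rho>. \<forall>v \<in> sphere u0 \<rho>. u \<noteq> v \<longrightarrow> dist (f u) (f v) < \<rho> + dist v (f u)"
  shows "fixes_circle f u0 \<rho>"
proof -
  have "f u = u" if u: "u \<in> sphere u0 \<rho>" for u
  proof (rule ccontr)
    assume ne: "f u \<noteq> u"
    from assms(2) obtain L where L: "L \<le> 0"
      "2 * dist u u0 - dist (f u) u0 \<le> theta \<rho> (dist u u0) + L * dist u (f u)"
      by blast
    have "dist u u0 = \<rho>"
      using u by (simp add: dist_commute)
    moreover have "L * dist u (f u) \<le> 0"
      using L(1) by (simp add: mult_nonpos_nonneg)
    \<comment> \<open>On the circle \<open>theta\<close> takes its exceptional value
      \<open>\<rho>\<close>, not \<open>\<rho> + \<rho>\<close>, so (1) becomes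
      \<open>2 * \<rho> - dist (f u) u0 \<le> \<rho> + L * dist u (f u)\<close>, whose last term is
      at most 0.\<close>
    ultimately have "dist (f u) u0 \<ge> \<rho>"
      using L(2) by (simp add: theta_def)
    then have fu: "f u \<in> sphere u0 \<rho>"
      using assms(3) u by (simp add: dist_commute order_antisym)
    have "2 * \<rho> \<le> dist (f u) (f (f u))"
      using assms(4) u fu ne by metis
    moreover have "dist (f u) (f (f u)) < \<rho> + dist (f u) (f u)"
      using assms(5) u fu ne by metis
    \<comment> \<open>As \<open>dist (f u) (f u) = 0\<close>, the two bounds give
      \<open>2 * \<rho> < \<rho>\<close>, i.e. \<open>\<rho> < 0\<close>; the strictness in (4) is
      what excludes the degenerate circle \<open>\<rho> = 0\<close>.\<close>
    ultimately show False
      using assms(1) by simp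
  qed
  then show ?thesis
    by (simp add: fixes_circle_def)
qed

end
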